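(* Let $L=(U,F,H)$ be a connected pseudograph with $n=|U|$ vertices and $k=|H|$ hanging edges. Then the number of valid orientations of $L$ is at most $$\alpha^n\,\beta^{k-1},\qquad \alpha=24^{1/5},\quad \beta=18^{-1/5}.$$ Equivalently, $P(n,k)\le \alpha^n\beta^{k-1}$, where $P(n,k)$ is the maximum number of valid orientations over all connected pseudographs with $n$ vertices and $k$ hanging edges.
   Context: A pseudograph $L=(U,F,H)$ consists of a finite set $U$ of vertices, a finite set $F$ of normal edges, each incident to two vertices of $U$, and a finite set $H$ of hanging edges, each having a single endpoint in $U$ and always directed out of that endpoint. The normal subgraph is the graph $(U,F)$; $L$ is connected if its normal subgraph is connected. An orientation of $L$ assigns a direction to every normal edge; the outdegree of a vertex counts all normal and hanging edges directed out of it. An orientation is valid if every vertex of $U$ has outdegree exactly $2$. *)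

theory Defs
  imports Complex_Main "HOL-Library.FuncSet"
begin

text \<open>
  The normal edges form a simple graph: a normal edge is the two-element set of its endpoints.
  The bound fails for loops and for parallel normal edges. For example, the path
  on three vertices with both edges doubled and one hanging edge at each end has 4 valid
  orientations, whereas the bound for 3 vertices and 2 hanging edges is about 3.78.
  Hanging edges are abstract, so several of them may share an endpoint.
\<close>

record ('v, 'h) pseudograph =
  verts :: "'v set"
  edges :: "'v set set"
  hanging :: "'h set"
  base :: "'h \<Rightarrow> 'v"

definition is_pseudograph :: "('v, 'h) pseudograph \<Rightarrow> bool" where
  "is_pseudograph L \<longleftrightarrow>
     finite (verts L) \<and> finite (edges L) \<and> finite (hanging L) \<and>
     (\<forall>e\<in>edges L. e \<subseteq> verts L \<and> card e = 2) \<and>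
     (\<forall>h\<in>hanging L. base L h \<in> verts L)"

definition connected_pseudograph :: "('v, 'h) pseudograph \<Rightarrow> bool" where
  "connected_pseudograph L \<longleftrightarrow>
     is_pseudograph L \<and> verts L \<noteq> {} \<and>
     (\<forall>u\<in>verts L. \<forall>v\<in>verts L. (u, v) \<in> {(x, y). {x, y} \<in> edges L}\<^sup>*)"

text \<open>
  An orientation is given by the function sending each normal edge to its tail.
  Taking it extensional makes each orientation a single function.
\<close>

definition orientations :: "('v, 'h) pseudograph \<Rightarrow> ('v set \<Rightarrow> 'v) set" where
  "orientations L = (\<Pi>\<^sub>E e\<in>edges L. e)"

definition outdegree :: "('v, 'h) pseudograph \<Rightarrow> ('v set \<Rightarrow> 'v) \<Rightarrow> 'v \<Rightarrow> nat" where
  "outdegree L t v = card {e \<in> edges L. t e = v} + card {h \<in> hanging L. base L h = v}"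

definition valid_orientations :: "('v, 'h) pseudograph \<Rightarrow> ('v set \<Rightarrow> 'v) set" where
  "valid_orientations L = {t \<in> orientations L. \<forall>v\<in>verts L. outdegree L t v = 2}"

text \<open>
  Every finite pseudograph is isomorphic to one whose vertices and hanging edges are natural
  numbers, so the maximum is taken over those.
\<close>

definition P :: "nat \<Rightarrow> nat \<Rightarrow> nat" where
  "P n k = Max {card (valid_orientations L) | L :: (nat, nat) pseudograph.
                  connected_pseudograph L \<and> card (verts L) = n \<and> card (hanging L) = k}"

end

theory Submission
  imports Defs
begin

text \<open>
  With \<open>a = 24 powr (1/5)\<close> and \<open>b = 18 powr (1/5)\<close> one has \<open>a * b\<^sup>2 = 6\<close> and \<open>a\<^sup>2 = 2 * b\<close>.
  Deleting a non-cut vertex of degree \<open>d\<close> with \<open>g\<close> hanging edges splits the count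
  into \<open>d choose (2 - g)\<close> counts for connected pseudographs with one vertex less and \<open>d - 2\<close>
  hanging edges more. By induction this suffices unless \<open>d = 2\<close> and \<open>g = 1\<close>. If \<open>x\<close> and \<open>y\<close> are
  two adjacent non-cut vertices of this exceptional kind, then \<open>y\<close> is a leaf after the deletion
  of \<open>x\<close>, and deleting both costs \<open>2 * b / a\<^sup>2 = 1\<close>. Finally, a minimal vertex set that is attached
  to the rest by a single vertex contains no cut vertex, so there always is either a non-cut vertex
  of degree one or a pair of adjacent non-cut vertices.
\<close>

section \<open>Simple graphs with prescribed numbers of hanging edges\<close>

definition simple_graph :: "'v set \<Rightarrow> 'v set set \<Rightarrow> bool" where
  "simple_graph V E \<longleftrightarrow> finite V \<and> (\<forall>e\<in>E. e \<subseteq> V \<and> card e = 2)"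

text \<open>Connectivity is phrased by cuts instead of paths: its failure hands over a separating
  set, and a cut extends easily over a deleted vertex.\<close>

definition cut_connected :: "'v set \<Rightarrow> 'v set set \<Rightarrow> bool" where
  "cut_connected V E \<longleftrightarrow> V \<noteq> {} \<and>
     (\<forall>S\<subseteq>V. S \<noteq> {} \<longrightarrow> S \<noteq> V \<longrightarrow> (\<exists>e\<in>E. e \<inter> S \<noteq> {} \<and> e \<inter> (V - S) \<noteq> {}))"

definition incident :: "'v set set \<Rightarrow> 'v \<Rightarrow> 'v set set" where
  "incident E x = {e \<in> E. x \<in> e}"

definition avoiding :: "'v set set \<Rightarrow> 'v \<Rightarrow> 'v set set" where
  "avoiding E x = {e \<in> E. x \<notin> e}"

text \<open>Only the number of hanging edges at each vertex matters for counting, so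
  \<open>g\<close> is an arbitrary function that the induction may change freely.\<close>

definition valid :: "'v set \<Rightarrow> 'v set set \<Rightarrow> ('v \<Rightarrow> nat) \<Rightarrow> ('v set \<Rightarrow> 'v) set" where
  "valid V E g = {t \<in> (\<Pi>\<^sub>E e\<in>E. e). \<forall>v\<in>V. card {e \<in> E. t e = v} + g v = 2}"

definition noncut :: "'v set \<Rightarrow> 'v set set \<Rightarrow> 'v \<Rightarrow> bool" where
  "noncut V E x \<longleftrightarrow> cut_connected (V - {x}) (avoiding E x)"

lemma simple_graph_finite_edges: "simple_graph V E \<Longrightarrow> finite E"
  unfolding simple_graph_def by (rule finite_subset[of _ "Pow V"]) auto

lemma simple_graph_delete: "simple_graph V E \<Longrightarrow> simple_graph (V - {x}) (avoiding E x)"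
  unfolding simple_graph_def avoiding_def by auto

lemma simple_graph_edge:
  assumes "simple_graph V E" "e \<in> E" "x \<in> e"
  shows "\<exists>y. y \<noteq> x \<and> e = {x, y}"
proof -
  have "card e = 2" using assms by (simp add: simple_graph_def)
  then obtain p q where "e = {p, q}" "p \<noteq> q" by (auto simp: card_2_iff)
  then show ?thesis using \<open>x \<in> e\<close> by (cases "x = p") auto
qed

lemma finite_valid: "simple_graph V E \<Longrightarrow> finite (valid V E g)"
proof -
  assume s: "simple_graph V E"
  have "finite (\<Pi>\<^sub>E e\<in>E. e)"
    by (intro finite_PiE simple_graph_finite_edges[OF s])
       (use s in \<open>auto simp: simple_graph_def intro: card_ge_0_finite\<close>)
  then show ?thesis unfolding valid_def by auto
qed

subsection \<open>Deletion of a vertex\<close>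

text \<open>
  \<open>T\<close> is the set of edges directed out of the deleted vertex; the other edges at
  that vertex become hanging edges of its neighbours.
\<close>

definition new_hanging :: "'v set set \<Rightarrow> 'v \<Rightarrow> ('v \<Rightarrow> nat) \<Rightarrow> 'v set set \<Rightarrow> 'v \<Rightarrow> nat" where
  "new_hanging E x g T v = g v + card {e \<in> incident E x - T. v \<in> e}"

text \<open>An orientation is determined by the set \<open>T\<close> of edges directed out of
  \<open>x\<close> and its restriction to the edges avoiding \<open>x\<close>: an edge at
  \<open>x\<close> outside \<open>T\<close> must leave its other endpoint. Validity at
  \<open>x\<close> forces \<open>card T + g x = 2\<close>.\<close>

lemma card_valid_delete:
  assumes s: "simple_graph V E" and x: "x \<in> V"
  shows "card (valid V E g) \<le>
    (\<Sum>T | T \<subseteq> incident E x \<and> card T + g x = 2.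
       card (valid (V - {x}) (avoiding E x) (new_hanging E x g T)))"
proof -
  define \<T> where "\<T> = {T. T \<subseteq> incident E x \<and> card T + g x = 2}"
  define B where "B T = valid (V - {x}) (avoiding E x) (new_hanging E x g T)" for T
  define out where "out t = {e \<in> incident E x. t e = x}" for t :: "'a set \<Rightarrow> 'a"
  define \<phi> where "\<phi> t = (out t, restrict t (avoiding E x))" for t
  have finE: "finite E" by (rule simple_graph_finite_edges[OF s])
  then have finI: "finite (incident E x)" by (simp add: incident_def)
  have fin\<T>: "finite \<T>" unfolding \<T>_def
    by (rule finite_subset[of _ "Pow (incident E x)"]) (use finI in auto)
  have finB: "finite (B T)" for T
    unfolding B_def by (rule finite_valid[OF simple_graph_delete[OF s]])
  have inj: "inj_on \<phi> (valid V E g)"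
  proof (rule inj_onI)
    fix t u assume t: "t \<in> valid V E g" and u: "u \<in> valid V E g" and eq: "\<phi> t = \<phi> u"
    have tu: "t \<in> (\<Pi>\<^sub>E e\<in>E. e)" "u \<in> (\<Pi>\<^sub>E e\<in>E. e)" using t u by (auto simp: valid_def)
    show "t = u"
    proof (rule PiE_ext[OF tu])
      fix e assume e: "e \<in> E"
      show "t e = u e"
      proof (cases "x \<in> e")
        case True
        then obtain y where y: "y \<noteq> x" "e = {x, y}"
          using simple_graph_edge[OF s e] by blast
        have "t e \<in> {x, y}" "u e \<in> {x, y}" using tu e y(2) by (auto simp: PiE_iff)
        moreover have "t e = x \<longleftrightarrow> u e = x"
          using eq e True by (auto simp: \<phi>_def out_def incident_def)
        ultimately show ?thesis by auto
      next
        case False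
        then have "e \<in> avoiding E x" using e by (simp add: avoiding_def)
        moreover have "restrict t (avoiding E x) = restrict u (avoiding E x)"
          using eq by (simp add: \<phi>_def)
        ultimately show ?thesis by (metis restrict_apply')
      qed
    qed
  qed
  have img: "\<phi> ` valid V E g \<subseteq> Sigma \<T> B"
  proof (rule image_subsetI)
    fix t assume t: "t \<in> valid V E g"
    have tE: "t \<in> (\<Pi>\<^sub>E e\<in>E. e)" and tv: "\<And>v. v \<in> V \<Longrightarrow> card {e \<in> E. t e = v} + g v = 2"
      using t by (auto simp: valid_def)
    have te: "t e \<in> e" if "e \<in> E" for e using tE that by (auto simp: PiE_iff)
    have "out t = {e \<in> E. t e = x}" using te by (auto simp: out_def incident_def)
    then have T: "out t \<in> \<T>" using tv[OF x] by (auto simp: \<T>_def out_def)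
    have "card {e \<in> avoiding E x. restrict t (avoiding E x) e = v} + new_hanging E x g (out t) v = 2"
      if v: "v \<in> V - {x}" for v
    proof -
      \<comment> \<open>An edge at \<open>x\<close> has only one other endpoint, so it is directed
        out of \<open>v\<close> iff it contains \<open>v\<close> and is not directed out of
        \<open>x\<close>.\<close>
      have "{e \<in> E. t e = v} =
          {e \<in> avoiding E x. restrict t (avoiding E x) e = v} \<union> {e \<in> incident E x - out t. v \<in> e}"
        (is "_ = ?A \<union> ?B")
      proof (intro set_eqI iffI)
        fix e assume "e \<in> {e \<in> E. t e = v}"
        then show "e \<in> ?A \<union> ?B"
          using v te by (auto simp: avoiding_def incident_def out_def)
      next
        fix e assume "e \<in> ?A \<union> ?B"
        then show "e \<in> {e \<in> E. t e = v}"
        proof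
          assume "e \<in> ?A" then show ?thesis by (auto simp: avoiding_def)
        next
          assume B: "e \<in> ?B"
          then have e: "e \<in> E" "x \<in> e" "v \<in> e" "t e \<noteq> x" by (auto simp: incident_def out_def)
          moreover obtain y where "e = {x, y}"
            using simple_graph_edge[OF s e(1,2)] by blast
          ultimately show ?thesis using te[of e] v by auto
        qed
      qed
      moreover have "?A \<inter> ?B = {}" by (auto simp: avoiding_def incident_def)
      moreover have "finite ?A" "finite ?B" using finE by (auto simp: avoiding_def incident_def)
      ultimately have "card {e \<in> E. t e = v} = card ?A + card ?B"
        by (simp add: card_Un_disjoint)
      then show ?thesis using tv[of v] v by (simp add: new_hanging_def)
    qed
    then have "restrict t (avoiding E x) \<in> B (out t)"
      using te by (auto simp: B_def valid_def avoiding_def)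
    then show "\<phi> t \<in> Sigma \<T> B" using T by (simp add: \<phi>_def)
  qed
  have "card (valid V E g) \<le> card (Sigma \<T> B)"
    by (rule card_inj_on_le[OF inj img]) (use fin\<T> finB in auto)
  also have "\<dots> = (\<Sum>T\<in>\<T>. card (B T))"
    using fin\<T> finB by (intro card_SigmaI) auto
  finally show ?thesis unfolding \<T>_def B_def .
qed

text \<open>Each edge at \<open>x\<close> outside \<open>T\<close> becomes one hanging edge, and the
  \<open>g x\<close> hanging edges at \<open>x\<close> disappear. The total does not depend on
  \<open>T\<close>.\<close>

lemma sum_new_hanging:
  assumes s: "simple_graph V E" and x: "x \<in> V"
    and T: "T \<subseteq> incident E x" "card T + g x = 2"
  shows "sum (new_hanging E x g T) (V - {x}) + 2 = sum g V + card (incident E x)"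
proof -
  have finV: "finite V" using s by (simp add: simple_graph_def)
  have finI: "finite (incident E x)"
    using simple_graph_finite_edges[OF s] by (simp add: incident_def)
  have "(\<Sum>v\<in>V - {x}. card {e \<in> incident E x - T. v \<in> e}) = 1 * card (incident E x - T)"
  proof (rule sum_multicount)
    show "\<forall>e\<in>incident E x - T. card {v \<in> V - {x}. v \<in> e} = 1"
    proof
      fix e assume "e \<in> incident E x - T"
      then have e: "e \<in> E" "x \<in> e" by (auto simp: incident_def)
      then obtain y where y: "y \<noteq> x" "e = {x, y}"
        using simple_graph_edge[OF s] by blast
      then have "{v \<in> V - {x}. v \<in> e} = {y}" using s e by (auto simp: simple_graph_def)
      then show "card {v \<in> V - {x}. v \<in> e} = 1" by simp
    qed
  qed (use finV finI in auto)
  moreover have "card (incident E x) = card (incident E x - T) + card T"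
    using card_Diff_subset[of T "incident E x"] card_mono[OF finI T(1)] finite_subset[OF T(1) finI] T(1)
    by simp
  moreover have "sum g V = g x + sum g (V - {x})" using finV x by (simp add: sum.remove)
  ultimately show ?thesis using T(2) by (simp add: new_hanging_def sum.distrib)
qed

text \<open>All choices of \<open>T\<close> obey the same bound, so only their number enters. The
  factor \<open>c\<close> is left free because the lemma is also applied with a sharper bound than
  the inductive one.\<close>

lemma card_valid_delete_bound:
  fixes b c :: real
  assumes s: "simple_graph V E" and x: "x \<in> V" and "c \<ge> 0"
    and bound: "\<And>g. real (card (valid (V - {x}) (avoiding E x) g)) \<le>
      c * b powr (1 - real (sum g (V - {x})))"
  shows "real (card (valid V E g)) \<le> real (card (incident E x) choose (2 - g x)) *
    (c * b powr (3 - real (sum g V) - real (card (incident E x))))"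
proof -
  define \<T> where "\<T> = {T. T \<subseteq> incident E x \<and> card T + g x = 2}"
  define M where "M = c * b powr (3 - real (sum g V) - real (card (incident E x)))"
  have M: "M \<ge> 0" using \<open>c \<ge> 0\<close> by (simp add: M_def)
  have finI: "finite (incident E x)"
    using simple_graph_finite_edges[OF s] by (simp add: incident_def)
  \<comment> \<open>Only an inequality: if \<open>g x > 2\<close>, the left set is empty, while
    truncated subtraction leaves the empty set on the right.\<close>
  have "card \<T> \<le> card {T. T \<subseteq> incident E x \<and> card T = 2 - g x}"
  proof (rule card_mono)
    show "finite {T. T \<subseteq> incident E x \<and> card T = 2 - g x}"
      by (rule finite_subset[of _ "Pow (incident E x)"]) (use finI in auto)
  qed (auto simp: \<T>_def)
  then have card\<T>: "card \<T> \<le> card (incident E x) choose (2 - g x)"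
    by (simp add: n_subsets[OF finI])
  have "real (card (valid V E g)) \<le>
      (\<Sum>T\<in>\<T>. real (card (valid (V - {x}) (avoiding E x) (new_hanging E x g T))))"
    using card_valid_delete[OF s x, of g] unfolding \<T>_def[symmetric]
    by (metis of_nat_le_iff of_nat_sum)
  also have "\<dots> \<le> (\<Sum>T\<in>\<T>. M)"
  proof (rule sum_mono)
    fix T assume "T \<in> \<T>"
    then have "sum (new_hanging E x g T) (V - {x}) + 2 = sum g V + card (incident E x)"
      by (intro sum_new_hanging[OF s x]) (auto simp: \<T>_def)
    then have "1 - real (sum (new_hanging E x g T) (V - {x})) =
        3 - real (sum g V) - real (card (incident E x))"
      by linarith
    then show "real (card (valid (V - {x}) (avoiding E x) (new_hanging E x g T))) \<le> M"
      using bound[of "new_hanging E x g T"] unfolding M_def by presburger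
  qed
  also have "\<dots> = real (card \<T>) * M" by simp
  also have "\<dots> \<le> real (card (incident E x) choose (2 - g x)) * M"
    using card\<T> M by (intro mult_right_mono) auto
  finally show ?thesis by (simp add: M_def)
qed

subsection \<open>Non-cut vertices\<close>

lemma incident_nonempty:
  assumes "cut_connected V E" "x \<in> V" "V \<noteq> {x}"
  shows "incident E x \<noteq> {}"
proof -
  obtain e where "e \<in> E" "e \<inter> {x} \<noteq> {}"
    using assms unfolding cut_connected_def by (metis empty_not_insert empty_subsetI insert_subset)
  then show ?thesis by (auto simp: incident_def)
qed

lemma noncut_leaf:
  assumes s: "simple_graph V E" and c: "cut_connected V E" and x: "x \<in> V" "V \<noteq> {x}"
    and leaf: "card (incident E x) = 1"
  shows "noncut V E x"
proof -
  obtain e0 where e0: "incident E x = {e0}" using leaf card_1_singletonE by blast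
  have "\<exists>e\<in>avoiding E x. e \<inter> S \<noteq> {} \<and> e \<inter> (V - {x} - S) \<noteq> {}"
    if S: "S \<subseteq> V - {x}" "S \<noteq> {}" "S \<noteq> V - {x}" for S
  proof -
    \<comment> \<open>the neighbour of the leaf lies on one side of the cut; put the leaf on that side too\<close>
    have "e0 \<in> E" "x \<in> e0" using e0 by (auto simp: incident_def)
    then obtain y where y: "y \<noteq> x" "e0 = {x, y}"
      using simple_graph_edge[OF s] by blast
    define S' where "S' = (if y \<in> S then insert x S else S)"
    have "S' \<subseteq> V" "S' \<noteq> {}" "S' \<noteq> V" using S x by (auto simp: S'_def)
    then obtain e where e: "e \<in> E" "e \<inter> S' \<noteq> {}" "e \<inter> (V - S') \<noteq> {}"
      using c unfolding cut_connected_def by metis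
    have "x \<notin> e"
    proof
      assume "x \<in> e"
      then have "e = {x, y}" using e(1) e0 y by (auto simp: incident_def)
      then show False using e S x by (auto simp: S'_def split: if_splits)
    qed
    then show ?thesis using e by (intro bexI[of _ e]) (auto simp: avoiding_def S'_def split: if_splits)
  qed
  then show ?thesis using x by (auto simp: noncut_def cut_connected_def)
qed

text \<open>\<open>C\<close> is a union of components left by the removal of \<open>v\<close>. Since
  it may be all of \<open>V - {v}\<close>, such a set exists even if no vertex is a cut
  vertex.\<close>

definition attached_at :: "'v set \<Rightarrow> 'v set set \<Rightarrow> 'v set \<Rightarrow> 'v \<Rightarrow> bool" where
  "attached_at V E C v \<longleftrightarrow> C \<subseteq> V \<and> C \<noteq> {} \<and> v \<in> V - C \<and>
     (\<forall>e\<in>E. e \<inter> C \<noteq> {} \<longrightarrow> e \<subseteq> insert v C)"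

text \<open>If \<open>w\<close> were a cut vertex, a side \<open>D\<close> of the graph without
  \<open>w\<close> would miss \<open>v\<close>. Then \<open>D \<inter> C\<close> would be attached
  at \<open>w\<close> and smaller than \<open>C\<close>, as it lacks \<open>w\<close>.\<close>

lemma noncut_in_minimal_attached:
  assumes s: "simple_graph V E" and c: "cut_connected V E" and C: "attached_at V E C v"
    and min: "\<And>C' v'. attached_at V E C' v' \<Longrightarrow> \<not> C' \<subset> C" and w: "w \<in> C"
  shows "noncut V E w"
proof (rule ccontr)
  assume nc: "\<not> noncut V E w"
  have vw: "v \<in> V" "v \<noteq> w" "w \<in> V" "v \<notin> C" using C w by (auto simp: attached_at_def)
  obtain S where S: "S \<subseteq> V - {w}" "S \<noteq> {}" "S \<noteq> V - {w}"
    "\<And>e. e \<in> E \<Longrightarrow> w \<notin> e \<Longrightarrow> e \<inter> S = {} \<or> e \<inter> (V - {w} - S) = {}"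
  proof -
    assume *: "\<And>S. S \<subseteq> V - {w} \<Longrightarrow> S \<noteq> {} \<Longrightarrow> S \<noteq> V - {w} \<Longrightarrow>
      (\<And>e. e \<in> E \<Longrightarrow> w \<notin> e \<Longrightarrow> e \<inter> S = {} \<or> e \<inter> (V - {w} - S) = {}) \<Longrightarrow> thesis"
    have "V - {w} \<noteq> {}" using vw by blast
    then obtain S where "S \<subseteq> V - {w}" "S \<noteq> {}" "S \<noteq> V - {w}"
      "\<forall>e\<in>avoiding E w. e \<inter> S = {} \<or> e \<inter> (V - {w} - S) = {}"
      using nc unfolding noncut_def cut_connected_def by metis
    then show thesis by (intro *) (auto simp: avoiding_def)
  qed
  have sub: "e \<subseteq> V" if "e \<in> E" for e using s that by (auto simp: simple_graph_def)
  have two: "e = {w, y}" if "e \<in> E" "w \<in> e" "y \<in> e" "y \<noteq> w" for e y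
    using simple_graph_edge[OF s that(1,2)] that by auto
  \<comment> \<open>Of the two sides of the cut, take the one that misses \<open>v\<close>.\<close>
  define D where "D = (if v \<in> S then V - {w} - S else S)"
  have D: "D \<subseteq> V" "w \<notin> D" "v \<notin> D" "D \<noteq> {}" using S vw by (auto simp: D_def)
  have closed: "e \<subseteq> insert w D" if e: "e \<in> E" "e \<inter> D \<noteq> {}" for e
  proof (cases "w \<in> e")
    case True
    then show ?thesis using two[OF e(1) True] D e(2) by auto
  next
    case False
    then show ?thesis using S(4)[OF e(1) False] sub[OF e(1)] e(2) by (auto simp: D_def split: if_splits)
  qed
  have closedC: "e \<subseteq> insert v C" if "e \<in> E" "e \<inter> C \<noteq> {}" for e
    using C that by (auto simp: attached_at_def)
  show False
  proof (cases "D \<inter> C = {}")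
    case True
    \<comment> \<open>By connectivity some edge leaves \<open>D\<close>, necessarily to
      \<open>w\<close>. But edges at \<open>w\<close> stay inside \<open>insert v C\<close>, which
      is disjoint from \<open>D\<close> here.\<close>
    obtain e where e: "e \<in> E" "e \<inter> D \<noteq> {}" "e \<inter> (V - D) \<noteq> {}"
      using c D vw unfolding cut_connected_def by metis
    then have "w \<in> e" using closed[of e] by auto
    then have "e \<subseteq> insert v C" using closedC[OF e(1)] w by auto
    then show False using e(2) True D by auto
  next
    case False
    have "attached_at V E (D \<inter> C) w"
      unfolding attached_at_def
    proof (intro conjI ballI impI)
      fix e assume "e \<in> E" "e \<inter> (D \<inter> C) \<noteq> {}"
      then have "e \<subseteq> insert w D" "e \<subseteq> insert v C" using closed closedC by auto
      then show "e \<subseteq> insert w (D \<inter> C)" using D w by auto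
    qed (use D vw False in auto)
    moreover have "D \<inter> C \<subset> C" using D w by auto
    ultimately show False using min by blast
  qed
qed

text \<open>Take any \<open>w\<close> in a minimal attached set \<open>C\<close>. Either its only
  neighbour is \<open>v\<close>, so that it is a leaf, or it has a neighbour in \<open>C\<close>,
  which is non-cut as well.\<close>

lemma noncut_leaf_or_adjacent:
  assumes s: "simple_graph V E" and c: "cut_connected V E" and V: "card V \<ge> 2"
  obtains (leaf) x where "x \<in> V" "noncut V E x" "card (incident E x) = 1"
  | (adjacent) x y where "x \<in> V" "y \<in> V" "x \<noteq> y" "{x, y} \<in> E" "noncut V E x" "noncut V E y"
proof -
  have finV: "finite V" and sub: "\<And>e. e \<in> E \<Longrightarrow> e \<subseteq> V" using s by (auto simp: simple_graph_def)
  obtain v0 where v0: "v0 \<in> V" using V by fastforce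
  have "V - {v0} \<noteq> {}"
    using V v0 card_mono[of "{v0}" V] by auto
  then have "attached_at V E (V - {v0}) v0"
    using v0 sub by (auto simp: attached_at_def)
  then have "\<exists>C. \<exists>v. attached_at V E C v" by blast
  \<comment> \<open>Minimal cardinality implies minimality under inclusion.\<close>
  then obtain C where "\<exists>v. attached_at V E C v"
    and mincard: "\<And>C'. \<exists>v. attached_at V E C' v \<Longrightarrow> card C \<le> card C'"
    using ex_has_least_nat[of "\<lambda>C. \<exists>v. attached_at V E C v" _ card] by metis
  then obtain v where C: "attached_at V E C v" by blast
  have finC: "finite C" using C finV finite_subset by (auto simp: attached_at_def)
  have min: "\<not> C' \<subset> C" if "attached_at V E C' v'" for C' v'
    using that mincard psubset_card_mono[OF finC] by (metis leD)
  have nc: "noncut V E u" if "u \<in> C" for u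
    by (rule noncut_in_minimal_attached[OF s c C _ that]) (rule min)
  obtain w where w: "w \<in> C" using C by (auto simp: attached_at_def)
  have wV: "w \<in> V" "v \<in> V" "v \<noteq> w" using w C by (auto simp: attached_at_def)
  show thesis
  proof (cases "\<forall>e\<in>incident E w. e \<subseteq> {v, w}")
    case True
    have "incident E w \<subseteq> {{v, w}}"
    proof
      fix e assume e: "e \<in> incident E w"
      then obtain y where "y \<noteq> w" "e = {w, y}"
        using simple_graph_edge[OF s] by (auto simp: incident_def)
      then show "e \<in> {{v, w}}" using True e by auto
    qed
    moreover have "incident E w \<noteq> {}" using incident_nonempty[OF c] wV by blast
    ultimately have "incident E w = {{v, w}}" by auto
    then show thesis using leaf[OF wV(1) nc[OF w]] by simp
  next
    case False
    then obtain e where e: "e \<in> E" "w \<in> e" "\<not> e \<subseteq> {v, w}" by (auto simp: incident_def)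
    then obtain y where y: "y \<noteq> w" "e = {w, y}"
      using simple_graph_edge[OF s e(1,2)] by blast
    have "e \<subseteq> insert v C" using C e(1,2) w by (auto simp: attached_at_def)
    then have yC: "y \<in> C" using y e(3) by auto
    then have "y \<in> V" using C by (auto simp: attached_at_def)
    then show thesis using adjacent[of w y] wV y e(1) nc[OF w] nc[OF yC] by auto
  qed
qed

subsection \<open>The counting bound\<close>

definition a :: real where "a = 24 powr (1 / 5)"
text \<open>This is the inverse of \<beta>, so the bound becomes
  \<open>a ^ n * b powr (1 - k)\<close> with both bases above 1.\<close>

definition b :: real where "b = 18 powr (1 / 5)"

lemma a_pos: "a > 0" and b_pos: "b > 0" by (simp_all add: a_def b_def)

lemma a_power5: "a ^ 5 = 24" and b_power5: "b ^ 5 = 18"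
  by (simp_all add: a_def b_def powr_power)

text \<open>The equality case of \<open>choose_bound\<close>: degree 4 without hanging edges, where
  6 is \<open>4 choose 2\<close>.\<close>

lemma a_b2: "a * b ^ 2 = 6"
proof (rule power_eq_imp_eq_base)
  have "(a * b ^ 2) ^ 5 = a ^ 5 * (b ^ 5) ^ 2" by (simp add: power_mult_distrib flip: power_mult)
  then show "(a * b ^ 2) ^ 5 = 6 ^ 5" by (simp add: a_power5 b_power5)
qed (use a_pos b_pos in auto)

text \<open>The equality case for two adjacent exceptional vertices. Together with
  \<open>a_b2\<close> it determines both constants.\<close>

lemma a_square: "a ^ 2 = 2 * b"
proof (rule power_eq_imp_eq_base)
  have "(a ^ 2) ^ 5 = (a ^ 5) ^ 2" by (simp flip: power_mult)
  then show "(a ^ 2) ^ 5 = (2 * b) ^ 5" by (simp add: power_mult_distrib a_power5 b_power5)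
qed (use a_pos b_pos in auto)

lemma b_lower: "b \<ge> 7 / 4" and b_upper: "b \<le> 9 / 5"
proof -
  show "b \<ge> 7 / 4"
    by (rule power_le_imp_le_base[of _ 4]) (use b_pos b_power5 in \<open>auto simp: power_divide\<close>)
  show "b \<le> 9 / 5"
    by (rule power_le_imp_le_base[of _ 4]) (use b_power5 in \<open>auto simp: power_divide\<close>)
qed

lemma b_le_a: "b \<le> a"
proof (rule power_le_imp_le_base[of _ 4])
  show "b ^ Suc 4 \<le> a ^ Suc 4" using a_power5 b_power5 by simp
qed (use a_pos in simp)

text \<open>This is the case \<open>g = 1\<close>, \<open>d = j + 3\<close> of
  \<open>choose_bound\<close>. The left side grows by a factor of at most 4/3 per step, which is
  below \<open>b\<close>.\<close>

lemma linear_le_power: "real (Suc j + 2) * b \<le> 6 * b ^ j"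
proof (induction j)
  case 0
  then show ?case using b_upper by simp
next
  case (Suc j)
  have "real (Suc (Suc j) + 2) \<le> real (Suc j + 2) * b"
    using mult_left_mono[OF b_lower, of "real (Suc j + 2)"] by simp
  then have "real (Suc (Suc j) + 2) * b \<le> (real (Suc j + 2) * b) * b"
    using b_pos by (intro mult_right_mono) auto
  also have "\<dots> \<le> (6 * b ^ j) * b" using Suc b_pos by (intro mult_right_mono) auto
  finally show ?case by (simp add: mult_ac)
qed

text \<open>This is the case \<open>g = 0\<close>, \<open>d = j + 4\<close> of
  \<open>choose_bound\<close>, with equality at \<open>j = 0\<close>. The left side grows by a
  factor of at most 5/3, below 7/4.\<close>

lemma quadratic_le_power: "real ((j + 4) * (j + 3)) \<le> 12 * b ^ j"
proof (induction j)
  case 0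
  then show ?case by simp
next
  case (Suc j)
  show ?case
  proof (cases j)
    case 0
    then show ?thesis using b_lower by simp
  next
    case (Suc i)
    have "real ((Suc j + 4) * (Suc j + 3)) \<le> real ((j + 4) * (j + 3)) * (7 / 4)"
      unfolding Suc by (simp add: field_simps)
    also have "\<dots> \<le> real ((j + 4) * (j + 3)) * b" using b_lower by (intro mult_left_mono) auto
    also have "\<dots> \<le> (12 * b ^ j) * b" using Suc.IH b_pos by (intro mult_right_mono) auto
    finally show ?thesis by (simp add: mult_ac)
  qed
qed

text \<open>Deleting a vertex costs at most a factor \<open>a\<close>. The excluded case really
  fails: it would require \<open>2 \<le> a\<close>, but \<open>a ^ 5 = 24 < 32\<close>.\<close>

lemma choose_bound:
  assumes d: "d \<ge> 1" and ex: "\<not> (d = 2 \<and> g = 1)"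
  shows "real (d choose (2 - g)) * b ^ 2 \<le> a * b ^ d"
proof -
  have b1: "b \<ge> 1" and b0: "b \<ge> 0" using b_lower by auto
  have bb: "b * b \<le> a * b" using b_le_a b0 by (rule mult_right_mono)
  have mono: "a * b \<le> a * b ^ d"
    using power_increasing[OF d b1] a_pos by simp
  \<comment> \<open>This settles every case in which the binomial coefficient is at most 1.\<close>
  have base: "b ^ 2 \<le> a * b ^ d" using bb mono by (simp add: power2_eq_square)
  consider "g \<ge> 2" | "g = 1" | "g = 0" by linarith
  then show ?thesis
  proof cases
    case 1
    then show ?thesis using base by simp
  next
    case 2
    show ?thesis
    proof (cases "d = 1")
      case True
      then show ?thesis using base 2 by simp
    next
      case False
      then obtain j where j: "d = j + 3" using ex 2 d by (metis One_nat_def Suc_1 add.commute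
            le_Suc_ex le_antisym not_less_eq_eq numeral_3_eq_3)
      have "real (j + 3) * b * b \<le> 6 * b ^ j * b"
        using linear_le_power[of j] b0 by (intro mult_right_mono) (auto simp: add_ac)
      also have "\<dots> = a * b ^ d" unfolding j a_b2[symmetric]
        by (simp add: power_add power2_eq_square power3_eq_cube)
      finally show ?thesis using 2 j by (simp add: power2_eq_square)
    qed
  next
    case 3
    consider "d = 1" | "d = 2" | "d = 3" | "d \<ge> 4" using d by linarith
    then show ?thesis
    proof cases
      case 3
      \<comment> \<open>For \<open>d = 3\<close> the claim reduces to
        \<open>b \<le> 2\<close>.\<close>
      have "3 * b\<^sup>2 \<le> 6 * b" using mult_right_mono[OF b_upper b0] b0 by (simp add: power2_eq_square)
      then have "3 * b\<^sup>2 \<le> a * b ^ 2 * b" by (simp add: a_b2)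
      moreover have "(3::nat) choose 2 = 3" by (simp add: numeral_eq_Suc)
      ultimately show ?thesis using 3 \<open>g = 0\<close> by (simp add: power2_eq_square power3_eq_cube mult_ac)
    next
      case 4
      then obtain j where j: "d = j + 4" by (metis add.commute le_Suc_ex)
      have "2 * (d choose 2) = (j + 4) * (j + 3)"
        by (simp add: j choose_two)
      then have "real (d choose 2) = real ((j + 4) * (j + 3)) / 2" by (metis of_nat_mult of_nat_numeral
            nonzero_mult_div_cancel_left zero_neq_numeral)
      then have "real (d choose 2) * b\<^sup>2 \<le> 6 * b ^ j * b\<^sup>2"
        using quadratic_le_power[of j] by (intro mult_right_mono) auto
      also have "\<dots> = a * b ^ d" unfolding j a_b2[symmetric]
        by (simp add: power_add power2_eq_square numeral_eq_Suc)
      finally show ?thesis using \<open>g = 0\<close> by simp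
    qed (use base a_pos b0 \<open>g = 0\<close> in \<open>auto simp: binomial_eq_0\<close>)
  qed
qed

section \<open>Induction on the number of vertices\<close>

lemma card_valid_bound:
  assumes "simple_graph V E" "cut_connected V E"
  shows "real (card (valid V E g)) \<le> a ^ card V * b powr (1 - real (sum g V))"
  using assms
proof (induction "card V" arbitrary: V E g rule: less_induct)
  case less
  note s = \<open>simple_graph V E\<close> and c = \<open>cut_connected V E\<close>
  have finV: "finite V" using s by (simp add: simple_graph_def)
  have ne: "V \<noteq> {}" using c by (simp add: cut_connected_def)
  have card_del: "a ^ card V = a * a ^ card (V - {x})" if "x \<in> V" for x
    using finV that by (metis card_Suc_Diff1 power_Suc)
  have IH: "real (card (valid (V - {x}) (avoiding E x) g')) \<le>
      a ^ card (V - {x}) * b powr (1 - real (sum g' (V - {x})))"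
    if "x \<in> V" "noncut V E x" for x g'
    using less.hyps[OF _ simple_graph_delete[OF s]] that finV
    by (simp add: noncut_def card_Diff1_less del: card_Diff_insert)
  \<comment> \<open>A non-cut vertex outside the exceptional case finishes the proof by a single
    deletion.\<close>
  have good: ?case if x: "x \<in> V" "noncut V E x" and "\<not> (card (incident E x) = 2 \<and> g x = 1)"
  for x
  proof -
    define d where "d = card (incident E x)"
    have "V \<noteq> {x}" using x by (auto simp: noncut_def cut_connected_def)
    then have "incident E x \<noteq> {}" using incident_nonempty[OF c x(1)] by blast
    moreover have "finite (incident E x)"
      using simple_graph_finite_edges[OF s] by (simp add: incident_def)
    ultimately have d: "d \<ge> 1" by (simp add: d_def Suc_le_eq card_gt_0_iff)
    let ?r = "b powr (1 - real (sum g V))"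
    have pw: "b powr (3 - real (sum g V) - real d) = ?r * b ^ 2 / b ^ d"
    proof -
      have eq: "3 - real (sum g V) - real d = (1 - real (sum g V)) + real 2 - real d" by simp
      show ?thesis
        unfolding eq powr_diff[of b _ "real d"] powr_add powr_realpow[OF b_pos] ..
    qed
    have "real (card (valid V E g)) \<le> real (d choose (2 - g x)) *
       (a ^ card (V - {x}) * b powr (3 - real (sum g V) - real d))"
      unfolding d_def
      by (rule card_valid_delete_bound[OF s x(1) _ IH[OF x]]) (use a_pos in simp)
    also have "\<dots> = (real (d choose (2 - g x)) * b ^ 2) * (a ^ card (V - {x}) * ?r / b ^ d)"
      unfolding pw by simp
    also have "\<dots> \<le> (a * b ^ d) * (a ^ card (V - {x}) * ?r / b ^ d)"
      using that(3) d a_pos b_pos by (intro mult_right_mono choose_bound) (auto simp: d_def)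
    also have "\<dots> = a ^ card V * ?r" using b_pos card_del[OF x(1)] by simp
    finally show ?thesis .
  qed
  show ?case
  proof (cases "card V \<ge> 2")
    case False
    then have "card V = 1" using ne finV by (metis One_nat_def Suc_1 card_0_eq le_SucE not_less_eq_eq
          le_zero_eq)
    then obtain x where V: "V = {x}" by (rule card_1_singletonE)
    have "E = {}"
    proof (rule ccontr)
      assume "E \<noteq> {}"
      then obtain e where "e \<subseteq> {x}" "card e = 2" using s V by (auto simp: simple_graph_def)
      then show False using card_mono[of "{x}" e] by simp
    qed
    then have val: "valid {x} E g = (if g x = 2 then {\<lambda>_. undefined} else {})"
      by (auto simp: valid_def)
    \<comment> \<open>The single, empty orientation is valid only if \<open>g x = 2\<close>, and
      then the bound equals \<open>a / b\<close>.\<close>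
    have "1 \<le> a / b" using b_le_a b_pos by simp
    then show ?thesis using a_pos b_pos by (auto simp: val V powr_minus_divide powr_neg_one)
  next
    case True
    with s c show ?thesis
    proof (cases rule: noncut_leaf_or_adjacent)
      case (leaf x)
      then show ?thesis using good[of x] by simp
    next
      case (adjacent x y)
      show ?thesis
      proof (cases "card (incident E x) = 2 \<and> g x = 1 \<and> card (incident E y) = 2 \<and> g y = 1")
        case False
        then show ?thesis using good[of x] good[of y] adjacent by blast
      next
        case dg: True
        let ?V = "V - {x}" and ?E = "avoiding E x"
        have sx: "simple_graph ?V ?E" by (rule simple_graph_delete[OF s])
        have cx: "cut_connected ?V ?E" using adjacent by (simp add: noncut_def)
        have y: "y \<in> ?V" using adjacent by simp
        have "incident ?E y = incident E y - {{x, y}}"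
        proof -
          have "e = {x, y}" if "e \<in> E" "x \<in> e" "y \<in> e" for e
            using simple_graph_edge[OF s that(1,2)] that adjacent(3) by auto
          then show ?thesis by (auto simp: incident_def avoiding_def)
        qed
        moreover have "{x, y} \<in> incident E y" using adjacent by (simp add: incident_def)
        \<comment> \<open>Of its two edges, \<open>y\<close> has lost exactly the one to
          \<open>x\<close>.\<close>
        ultimately have leaf: "card (incident ?E y) = 1"
          using dg by (simp add: card_Diff_singleton)
        have "?V \<noteq> {y}"
        proof
          assume "?V = {y}"
          obtain e where e: "e \<in> incident ?E y" using leaf by fastforce
          then have "e \<subseteq> {y}" "card e = 2"
            using sx \<open>?V = {y}\<close> by (auto simp: incident_def simple_graph_def)
          then show False using card_mono[of "{y}" e] by simp
        qed
        then have ncy: "noncut ?V ?E y" by (rule noncut_leaf[OF sx cx y _ leaf])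
        let ?c = "a ^ card (?V - {y})"
        have less2: "card (?V - {y}) < card V"
          using finV adjacent by (intro psubset_card_mono) auto
        have IHy: "real (card (valid (?V - {y}) (avoiding ?E y) g')) \<le>
            ?c * b powr (1 - real (sum g' (?V - {y})))" for g'
          by (rule less.hyps[OF less2 simple_graph_delete[OF sx]]) (use ncy in \<open>simp add: noncut_def\<close>)
        \<comment> \<open>Deleting the leaf \<open>y\<close> leaves at most one choice and lowers
          the total of hanging edges by one, so it costs only \<open>b\<close> instead of
          \<open>a\<close>.\<close>
        have step: "real (card (valid ?V ?E g')) \<le> (?c * b) * b powr (1 - real (sum g' ?V))" for g'
        proof -
          have "real (card (valid ?V ?E g')) \<le> real (1 choose (2 - g' y)) *
             (?c * b powr (3 - real (sum g' ?V) - real 1))"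
            using card_valid_delete_bound[OF sx y _ IHy, of g'] a_pos leaf by simp
          also have "\<dots> \<le> 1 * (?c * b powr (3 - real (sum g' ?V) - real 1))"
          proof (intro mult_right_mono)
            have "1 choose j \<le> (1::nat)" for j by (cases j; cases "j - 1") auto
            then show "real (1 choose (2 - g' y)) \<le> 1" by (metis of_nat_1 of_nat_le_iff)
          qed (use a_pos in simp)
          also have "b powr (3 - real (sum g' ?V) - real 1) = b * b powr (1 - real (sum g' ?V))"
            using b_pos by (simp add: powr_mult_base algebra_simps)
          finally show ?thesis by (simp add: mult_ac)
        qed
        \<comment> \<open>Deleting \<open>x\<close> leaves two choices and, since its degree is 2,
          keeps the total of hanging edges. Both deletions together cost \<open>2 * b\<close>, which
          is \<open>a ^ 2\<close>.\<close>
        have "real (card (valid V E g)) \<le> real (2 choose 1) *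
            ((?c * b) * b powr (3 - real (sum g V) - real 2))"
          using card_valid_delete_bound[OF s adjacent(1) _ step, of g] a_pos b_pos dg by simp
        also have "\<dots> = (2 * b) * ?c * b powr (1 - real (sum g V))"
        proof -
          have eq: "3 - real (sum g V) - real 2 = 1 - real (sum g V)" by simp
          show ?thesis unfolding eq by simp
        qed
        also have "\<dots> = a ^ card V * b powr (1 - real (sum g V))"
        proof -
          have "card V = Suc (Suc (card (?V - {y})))"
            using finV adjacent(1) y by (metis card_Suc_Diff1 finite_Diff)
          then show ?thesis using a_square by (simp add: power2_eq_square mult_ac)
        qed
        finally show ?thesis .
      qed
    qed
  qed
qed

section \<open>Transfer to pseudographs\<close>

text \<open>A path from inside \<open>S\<close> to outside must contain an edge that crosses the
  cut.\<close>

lemma connected_imp_cut_connected: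
  assumes "connected_pseudograph L"
  shows "cut_connected (verts L) (edges L)"
  unfolding cut_connected_def
proof (intro conjI allI impI)
  show "verts L \<noteq> {}" using assms by (simp add: connected_pseudograph_def)
next
  fix S assume S: "S \<subseteq> verts L" "S \<noteq> {}" "S \<noteq> verts L"
  then obtain u v where uv: "u \<in> S" "v \<in> verts L" "v \<notin> S" by blast
  then have "(u, v) \<in> {(x, y). {x, y} \<in> edges L}\<^sup>*"
    using assms S by (auto simp: connected_pseudograph_def)
  moreover have sub: "e \<subseteq> verts L" if "e \<in> edges L" for e
    using assms that by (auto simp: connected_pseudograph_def is_pseudograph_def)
  ultimately show "\<exists>e\<in>edges L. e \<inter> S \<noteq> {} \<and> e \<inter> (verts L - S) \<noteq> {}"
    using uv
  proof (induction rule: rtrancl_induct)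
    case base
    then show ?case by simp
  next
    case (step y z)
    show ?case
    proof (cases "y \<in> S")
      case True
      then show ?thesis using step by (intro bexI[of _ "{y, z}"]) auto
    next
      case False
      moreover have "y \<in> verts L" using step by fastforce
      ultimately show ?thesis using step by blast
    qed
  qed
qed

lemma card_valid_orientations_bound:
  assumes L: "connected_pseudograph L"
  shows "real (card (valid_orientations L)) \<le>
    a ^ card (verts L) * b powr (1 - real (card (hanging L)))"
proof -
  have ps: "is_pseudograph L" using L by (simp add: connected_pseudograph_def)
  define g where "g v = card {h \<in> hanging L. base L h = v}" for v
  have eq: "valid_orientations L = valid (verts L) (edges L) g"
    by (simp add: valid_orientations_def orientations_def outdegree_def valid_def g_def)
  have "simple_graph (verts L) (edges L)"
    using ps by (auto simp: simple_graph_def is_pseudograph_def)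
  moreover have "sum g (verts L) = card (hanging L)"
  proof -
    have "sum g (verts L) = 1 * card (hanging L)"
      unfolding g_def
    proof (rule sum_multicount)
      show "\<forall>h\<in>hanging L. card {v \<in> verts L. base L h = v} = 1"
      proof
        fix h assume "h \<in> hanging L"
        then have "{v \<in> verts L. base L h = v} = {base L h}"
          using ps by (auto simp: is_pseudograph_def)
        then show "card {v \<in> verts L. base L h = v} = 1" by simp
      qed
    qed (use ps in \<open>auto simp: is_pseudograph_def\<close>)
    then show ?thesis by simp
  qed
  ultimately show ?thesis
    using card_valid_bound[OF _ connected_imp_cut_connected[OF L], of g] eq by simp
qed

text \<open>\<open>Max\<close> has an unspecified value on the empty set, so some pseudograph must be exhibited.\<close>

lemma ex_connected_pseudograph:
  assumes "n \<ge> 1"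
  shows "\<exists>L :: (nat, nat) pseudograph.
    connected_pseudograph L \<and> card (verts L) = n \<and> card (hanging L) = k"
proof -
  \<comment> \<open>A star centred at 0 that carries all hanging edges; it need not have any valid
    orientation.\<close>
  define L :: "(nat, nat) pseudograph" where
    "L = \<lparr>verts = {..<n}, edges = (\<lambda>i. {0, i}) ` {1..<n}, hanging = {..<k}, base = \<lambda>_. 0\<rparr>"
  let ?R = "{(x, y). {x, y} \<in> edges L}"
  have to: "(0, u) \<in> ?R\<^sup>*" "(u, 0) \<in> ?R\<^sup>*" if "u < n" for u
  proof -
    have "u = 0 \<or> {0, u} \<in> edges L" using that by (auto simp: L_def)
    then show "(0, u) \<in> ?R\<^sup>*" "(u, 0) \<in> ?R\<^sup>*" by (auto simp: insert_commute intro: r_into_rtrancl)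
  qed
  have "is_pseudograph L" using assms by (auto simp: is_pseudograph_def L_def)
  moreover have "(u, v) \<in> ?R\<^sup>*" if "u \<in> verts L" "v \<in> verts L" for u v
    using to(2)[of u] to(1)[of v] that by (auto simp: L_def intro: rtrancl_trans)
  moreover have "verts L \<noteq> {}" using assms by (auto simp: L_def lessThan_empty_iff)
  ultimately have "connected_pseudograph L" by (simp add: connected_pseudograph_def)
  then show ?thesis by (intro exI[of _ L]) (simp add: L_def)
qed

theorem theorem2:
  fixes L :: "('v, 'h) pseudograph" and n k :: nat and \<alpha> \<beta> :: real
  assumes "connected_pseudograph L"
    and "card (verts L) = n" and "card (hanging L) = k"
    and "\<alpha> = 24 powr (1 / 5)" and "\<beta> = 18 powr (- 1 / 5)"
  shows "real (card (valid_orientations L)) \<le> \<alpha> ^ n * \<beta> powi (int k - 1) \<and>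
         real (P n k) \<le> \<alpha> ^ n * \<beta> powi (int k - 1)"
proof -
  have \<alpha>: "\<alpha> = a" using assms(4) by (simp add: a_def)
  \<comment> \<open>The exponent is an integer power because it is -1 for
    \<open>k = 0\<close>.\<close>
  have "\<beta> powi (int k - 1) = \<beta> powr (real_of_int (int k - 1))"
    by (rule powr_real_of_int'[symmetric]) (use assms(5) in auto)
  also have "\<dots> = b powr (1 - real k)"
    by (simp add: assms(5) b_def powr_powr algebra_simps diff_divide_distrib)
  finally have \<beta>: "\<beta> powi (int k - 1) = b powr (1 - real k)" .
  define B where "B = a ^ n * b powr (1 - real k)"
  define M where "M = {card (valid_orientations L) | L :: (nat, nat) pseudograph.
                  connected_pseudograph L \<and> card (verts L) = n \<and> card (hanging L) = k}"
  have bound: "real m \<le> B" if "m \<in> M" for m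
    using that card_valid_orientations_bound by (auto simp: M_def B_def)
  \<comment> \<open>The bound itself confines \<open>M\<close> to finitely many naturals, so its
    maximum is attained.\<close>
  have "finite M"
  proof (rule finite_subset)
    show "M \<subseteq> {..nat \<lfloor>B\<rfloor>}" using bound by (auto simp: le_nat_floor)
  qed simp
  moreover have "n \<ge> 1"
    using assms(1,2) by (auto simp: connected_pseudograph_def is_pseudograph_def Suc_le_eq card_gt_0_iff)
  then have "M \<noteq> {}" using ex_connected_pseudograph[of n k] by (auto simp: M_def)
  ultimately have "Max M \<in> M" by (rule Max_in)
  then have "real (P n k) \<le> B" using bound by (simp add: P_def M_def)
  moreover have "real (card (valid_orientations L)) \<le> B"
    using card_valid_orientations_bound[OF assms(1)] assms(2,3) by (simp add: B_def)
  ultimately show ?thesis by (simp add: \<alpha> \<beta> B_def)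
qed

end
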